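(* Let $\mathbb{F}$ be $\mathbb{R}$ or $\mathbb{C}$, let $H$ be an infinite-dimensional separable Hilbert space over $\mathbb{F}$, and let $n\ge 1$ be an integer. Then $\operatorname{St}_{\operatorname{orth}}(n,H)$ is contractible, hence connected.
   Context: $\operatorname{St}_{\operatorname{orth}}(n,H) = \{(v_1,\ldots,v_n)\in H^n : \langle v_i,v_j\rangle = \delta_{ij} \text{ for all } i,j\}$, with the subspace topology from the norm topology on $H^n$. *)

theory Defs
  imports "HOL-Analysis.Analysis"
begin

text \<open>
  Complex inner product spaces, as the counterpart of the library class \<^class>\<open>real_inner\<close>.
  The inner product is linear in the first argument and conjugate-linear in the second; it is
  tied to the existing norm, metric and topology by \<open>norm_eq_sqrt_cinner\<close>, and the
  complex scalar multiplication extends the real one by \<open>scaleC_of_real\<close>.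
\<close>

class complex_inner = real_normed_vector +
  fixes scaleC :: "complex \<Rightarrow> 'a \<Rightarrow> 'a"  (infixr "*\<^sub>C" 75)
    and cinner :: "'a \<Rightarrow> 'a \<Rightarrow> complex"
  assumes scaleC_add_right: "a *\<^sub>C (x + y) = a *\<^sub>C x + a *\<^sub>C y"
    and scaleC_add_left: "(a + b) *\<^sub>C x = a *\<^sub>C x + b *\<^sub>C x"
    and scaleC_scaleC: "a *\<^sub>C b *\<^sub>C x = (a * b) *\<^sub>C x"
    and scaleC_one: "1 *\<^sub>C x = x"
    and scaleC_of_real: "complex_of_real r *\<^sub>C x = r *\<^sub>R x"
    and cinner_commute: "cinner x y = cnj (cinner y x)"
    and cinner_add_left: "cinner (x + y) z = cinner x z + cinner y z"
    and cinner_scaleC_left: "cinner (a *\<^sub>C x) y = a * cinner x y"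
    and cinner_ge_zero: "0 \<le> Re (cinner x x)"
    and cinner_eq_zero_iff: "cinner x x = 0 \<longleftrightarrow> x = 0"
    and norm_eq_sqrt_cinner: "norm x = sqrt (Re (cinner x x))"

interpretation complex_vector: vector_space "scaleC :: complex \<Rightarrow> 'a \<Rightarrow> 'a::complex_inner"
  by unfold_locales (simp_all add: scaleC_add_right scaleC_add_left scaleC_scaleC scaleC_one)

instantiation complex :: complex_inner
begin

definition scaleC_complex :: "complex \<Rightarrow> complex \<Rightarrow> complex" where
  "scaleC_complex a x = a * x"

definition cinner_complex :: "complex \<Rightarrow> complex \<Rightarrow> complex" where
  "cinner_complex x y = x * cnj y"

instance
  by standard
    (simp_all add: scaleC_complex_def cinner_complex_def algebra_simps scaleR_conv_of_real
      cmod_def power2_eq_square)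

end

text \<open>
  The orthonormal Stiefel set, for an inner product \<open>ip\<close> that is either
  \<^const>\<open>inner\<close> or \<^const>\<open>cinner\<close>.  An \<open>n\<close>-tuple of vectors is an element
  of \<open>'h ^ 'n\<close> with \<open>n = CARD('n)\<close>, so \<open>n \<ge> 1\<close> holds automatically;
  the topology of \<open>'h ^ 'n\<close> is that of its norm, the l2 norm of the norms of the entries.
\<close>

definition St_orth :: "('h \<Rightarrow> 'h \<Rightarrow> 'k::zero_neq_one) \<Rightarrow> ('h ^ 'n) set" where
  "St_orth ip = {v. \<forall>i j. ip (v $ i) (v $ j) = (if i = j then 1 else 0)}"

end

theory Submission
  imports Defs
begin

text \<open>
  Let \<open>e\<close> be an orthonormal sequence and let \<open>S\<close> shift it by \<open>n\<close> on its closed span \<open>M\<close> and fix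
  the orthogonal complement of \<open>M\<close>.  Every \<open>(1 - t) I + t S\<close> is injective, because the shift has no
  eigenvalues, and the range of \<open>S\<close> is orthogonal to the frame \<open>w = (e 0, \<dots>, e (n - 1))\<close>.  Hence both
  segments \<open>(1 - t) v + t S v\<close> and \<open>(1 - t) S v + t w\<close> consist of linearly independent tuples, and
  the Gram-Schmidt process turns them into homotopies inside the Stiefel set from the identity to
  the constant map \<open>w\<close>.
\<close>

text \<open>Real and complex Hilbert spaces at once; \<open>cj\<close> is the conjugation of the scalar field.\<close>

locale complete_inner_space = vector_space scale
  for scale :: "'k::real_normed_field \<Rightarrow> 'h::{real_normed_vector, complete_space} \<Rightarrow> 'h"
      (infixr "\<star>" 75) +
  fixes ip :: "'h \<Rightarrow> 'h \<Rightarrow> 'k" and cj :: "'k \<Rightarrow> 'k"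
  assumes scale_of_real: "of_real r \<star> x = r *\<^sub>R x"
    and ip_commute: "ip x y = cj (ip y x)"
    and ip_add_left: "ip (x + y) z = ip x z + ip y z"
    and ip_scale_left: "ip (a \<star> x) y = a * ip x y"
    and ip_self: "ip x x = of_real ((norm x)\<^sup>2)"
    and cj_add: "cj (a + b) = cj a + cj b"
    and cj_mult: "cj (a * b) = cj a * cj b"
    and mult_cj: "a * cj a = of_real ((norm a)\<^sup>2)"
begin

section \<open>Sesquilinear algebra, Cauchy-Schwarz and continuity\<close>

lemma cj_zero [simp]: "cj 0 = 0"
  using cj_add[of 0 0] by simp

lemma cj_of_real [simp]: "cj (of_real r) = of_real r"
  using mult_cj[of "of_real r"] by (cases "r = 0") (auto simp: power2_eq_square)

lemma ip_add_right: "ip x (y + z) = ip x y + ip x z"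
  by (metis ip_commute ip_add_left cj_add)

lemma ip_scale_right: "ip x (a \<star> y) = cj a * ip x y"
  by (metis ip_commute ip_scale_left cj_mult)

lemma ip_zero_left [simp]: "ip 0 y = 0"
  using ip_add_left[of 0 0 y] by simp

lemma ip_zero_right [simp]: "ip x 0 = 0"
  using ip_add_right[of x 0 0] by simp

lemma ip_diff_left: "ip (x - y) z = ip x z - ip y z"
  using ip_add_left[of "x - y" y z] by simp

lemma ip_sum_left: "ip (\<Sum>i\<in>I. f i) y = (\<Sum>i\<in>I. ip (f i) y)"
  by (induction I rule: infinite_finite_induct) (simp_all add: ip_add_left)

lemma ip_sum_right: "ip x (\<Sum>i\<in>I. f i) = (\<Sum>i\<in>I. ip x (f i))"
  by (induction I rule: infinite_finite_induct) (simp_all add: ip_add_right)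

lemma ip_eq_zero_commute: "ip x y = 0 \<longleftrightarrow> ip y x = 0"
  by (metis ip_commute cj_zero)

text \<open>The ambient norm is a priori homogeneous for real scalars only; for scalars in
  \<open>'k\<close> this follows from \<open>ip_self\<close> and \<open>mult_cj\<close>.\<close>

lemma norm_scale: "norm (a \<star> x) = norm a * norm x"
proof -
  have "of_real ((norm (a \<star> x))\<^sup>2) = (a * cj a) * ip x x"
    unfolding ip_self[symmetric] ip_scale_left ip_scale_right by (simp add: mult_ac)
  also have "\<dots> = of_real ((norm a * norm x)\<^sup>2)"
    by (simp add: mult_cj ip_self power_mult_distrib)
  finally show ?thesis
    unfolding of_real_eq_iff by (simp add: power2_eq_iff_nonneg)
qed

lemma scaleR_scale: "r *\<^sub>R (a \<star> x) = a \<star> (r *\<^sub>R x)"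
  by (simp add: scale_of_real[symmetric] mult.commute)

lemma pythagoras:
  assumes "ip x y = 0"
  shows "(norm (x + y))\<^sup>2 = (norm x)\<^sup>2 + (norm y)\<^sup>2"
proof -
  have "ip y x = 0"
    using assms ip_eq_zero_commute by blast
  then have "ip (x + y) (x + y) = ip x x + ip y y"
    using assms by (simp add: ip_add_left ip_add_right)
  then show ?thesis
    unfolding ip_self of_real_add[symmetric] of_real_eq_iff .
qed

text \<open>The vector \<open>a \<star> y\<close> is the projection of \<open>x\<close> onto the
  line of \<open>y\<close>; by Pythagoras it is no longer than \<open>x\<close>.\<close>

lemma Cauchy_Schwarz: "norm (ip x y) \<le> norm x * norm y"
proof (cases "y = 0")
  case False
  define a where "a = ip x y / of_real ((norm y)\<^sup>2)"
  have "ip (x - a \<star> y) y = 0"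
    using False by (simp add: a_def ip_diff_left ip_scale_left ip_self)
  then have "ip (x - a \<star> y) (a \<star> y) = 0"
    by (simp add: ip_scale_right)
  from pythagoras[OF this] have "(norm (a \<star> y))\<^sup>2 \<le> (norm x)\<^sup>2"
    by simp
  then have "norm (a \<star> y) \<le> norm x"
    by (simp add: power2_le_iff_abs_le)
  then show ?thesis
    using False
    by (simp add: norm_scale a_def norm_divide norm_mult power2_eq_square field_simps)
qed simp

text \<open>Conjugate-linearity is still linearity over the reals, so the limit and continuity rules
  for bounded bilinear maps become available.\<close>

sublocale ip: bounded_bilinear ip
proof
  show "ip (r *\<^sub>R x) y = r *\<^sub>R ip x y" for r x y
    by (simp add: scale_of_real[symmetric] ip_scale_left scaleR_conv_of_real)
  show "ip x (r *\<^sub>R y) = r *\<^sub>R ip x y" for r x y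
    by (simp add: scale_of_real[symmetric] ip_scale_right scaleR_conv_of_real)
  show "\<exists>K. \<forall>a b. norm (ip a b) \<le> norm a * norm b * K"
    using Cauchy_Schwarz by (intro exI[of _ 1]) simp
qed (simp_all add: ip_add_left ip_add_right)

sublocale scale: bounded_bilinear scale
proof
  show "(r *\<^sub>R a) \<star> x = r *\<^sub>R (a \<star> x)" for r a x
    by (simp add: scale_of_real[symmetric] scaleR_conv_of_real)
  show "a \<star> (r *\<^sub>R x) = r *\<^sub>R (a \<star> x)" for r a x
    by (simp add: scaleR_scale)
  show "\<exists>K. \<forall>a b. norm (a \<star> b) \<le> norm a * norm b * K"
    by (intro exI[of _ 1]) (simp add: norm_scale)
qed (simp_all add: scale_left_distrib scale_right_distrib)

subsection \<open>Orthonormal families\<close>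

definition orthonormal_on :: "'i set \<Rightarrow> ('i \<Rightarrow> 'h) \<Rightarrow> bool" where
  "orthonormal_on I e \<longleftrightarrow> (\<forall>i\<in>I. \<forall>j\<in>I. ip (e i) (e j) = (if i = j then 1 else 0))"

lemma orthonormal_onD:
  "orthonormal_on I e \<Longrightarrow> i \<in> I \<Longrightarrow> j \<in> I \<Longrightarrow> ip (e i) (e j) = (if i = j then 1 else 0)"
  by (simp add: orthonormal_on_def)

lemma orthonormal_on_subset: "orthonormal_on I e \<Longrightarrow> J \<subseteq> I \<Longrightarrow> orthonormal_on J e"
  by (simp add: orthonormal_on_def subset_iff)

lemma norm_orthonormal: "orthonormal_on I e \<Longrightarrow> i \<in> I \<Longrightarrow> norm (e i) = 1"
  using ip_self[of "e i"] orthonormal_onD[of I e i i]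
  by (metis norm_ge_zero of_real_eq_1_iff power2_eq_1_iff abs_norm_cancel abs_1 abs_minus_cancel)

lemma ip_orthonormal_sum:
  assumes "orthonormal_on I e" "finite J" "J \<subseteq> I" "j \<in> I"
  shows "ip (\<Sum>i\<in>J. c i \<star> e i) (e j) = (if j \<in> J then c j else 0)"
proof -
  have "ip (\<Sum>i\<in>J. c i \<star> e i) (e j) = (\<Sum>i\<in>J. if i = j then c i else 0)"
    unfolding ip_sum_left ip_scale_left
    using assms by (intro sum.cong) (auto simp: orthonormal_onD[OF assms(1)] subset_iff)
  then show ?thesis
    using assms(2) by simp
qed

lemma norm_orthonormal_sum:
  assumes "orthonormal_on I e" "finite I"
  shows "(norm (\<Sum>i\<in>I. c i \<star> e i))\<^sup>2 = (\<Sum>i\<in>I. (norm (c i))\<^sup>2)"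
  using assms(2,1)
proof (induction I)
  case (insert k I)
  have "ip (\<Sum>i\<in>I. c i \<star> e i) (e k) = 0"
    using ip_orthonormal_sum[OF insert.prems insert.hyps(1), of k c] insert.hyps(2) by auto
  then have "ip (c k \<star> e k) (\<Sum>i\<in>I. c i \<star> e i) = 0"
    using ip_eq_zero_commute by (simp add: ip_scale_left)
  moreover have "orthonormal_on I e"
    using insert.prems by (rule orthonormal_on_subset) auto
  ultimately show ?case
    using insert norm_orthonormal[OF insert.prems, of k] by (simp add: pythagoras norm_scale)
qed simp

text \<open>Here \<open>p\<close> is the orthogonal projection of \<open>x\<close> onto the span of
  the family; the left side is its squared norm.\<close>

lemma Bessel:
  assumes "orthonormal_on I e" "finite I"
  shows "(\<Sum>i\<in>I. (norm (ip x (e i)))\<^sup>2) \<le> (norm x)\<^sup>2"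
proof -
  define p where "p = (\<Sum>i\<in>I. ip x (e i) \<star> e i)"
  have "ip (x - p) (e j) = 0" if "j \<in> I" for j
    using ip_orthonormal_sum[OF assms subset_refl that] that by (simp add: p_def ip_diff_left)
  then have "ip (x - p) p = 0"
    by (subst (2) p_def) (simp add: ip_sum_right ip_scale_right)
  from pythagoras[OF this] show ?thesis
    using norm_orthonormal_sum[OF assms, of "\<lambda>i. ip x (e i)"] by (simp add: p_def)
qed

section \<open>Transfer operators and the partial shift\<close>

text \<open>For orthonormal \<open>e\<close> and \<open>g\<close> this is the partial isometry
  sending \<open>e i\<close> to \<open>g i\<close> and killing the orthogonal complement of
  \<open>e\<close>; for \<open>g = e\<close> it is the orthogonal projection onto the closed
  span.\<close>

definition transfer_series :: "(nat \<Rightarrow> 'h) \<Rightarrow> (nat \<Rightarrow> 'h) \<Rightarrow> 'h \<Rightarrow> 'h" where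
  "transfer_series e g x = lim (\<lambda>m. \<Sum>i<m. ip x (e i) \<star> g i)"

text \<open>Squared distances of the partial sums are differences of the sums \<open>q\<close>,
  which are increasing and bounded by Bessel. So the partial sums are Cauchy, and completeness gives
  the limit.\<close>

lemma transfer_series_LIMSEQ:
  assumes e: "orthonormal_on UNIV e" and g: "orthonormal_on UNIV g"
  shows "(\<lambda>m. \<Sum>i<m. ip x (e i) \<star> g i) \<longlonglongrightarrow> transfer_series e g x"
proof -
  define s where "s m = (\<Sum>i<m. ip x (e i) \<star> g i)" for m
  define q where "q m = (\<Sum>i<m. (norm (ip x (e i)))\<^sup>2)" for m
  have dist_s: "(dist (s m) (s n))\<^sup>2 = q n - q m" if "m \<le> n" for m n
  proof -
    have "{..<n} = {..<m} \<union> {m..<n}"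
      using that by auto
    then have "s n - s m = (\<Sum>i\<in>{m..<n}. ip x (e i) \<star> g i)"
      "q n - q m = (\<Sum>i\<in>{m..<n}. (norm (ip x (e i)))\<^sup>2)"
      by (simp_all add: s_def q_def sum.union_disjoint ivl_disj_int)
    then have "(norm (s n - s m))\<^sup>2 = q n - q m"
      using norm_orthonormal_sum[OF orthonormal_on_subset[OF g subset_UNIV], of "{m..<n}"]
      by simp
    then show ?thesis
      by (simp only: dist_norm norm_minus_commute)
  qed
  have "convergent q"
  proof (intro Bseq_mono_convergent BseqI' allI impI)
    have "q m \<le> (norm x)\<^sup>2" for m
      unfolding q_def by (rule Bessel[OF orthonormal_on_subset[OF e subset_UNIV]]) simp
    moreover have "0 \<le> q m" for m
      unfolding q_def by (rule sum_nonneg) simp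
    ultimately show "norm (q m) \<le> (norm x)\<^sup>2" for m
      by simp
    show "q m \<le> q n" if "m \<le> n" for m n
      unfolding q_def by (rule sum_mono2) (use that in auto)
  qed
  then have "Cauchy q"
    by (rule convergent_Cauchy)
  have "Cauchy s"
    unfolding Cauchy_altdef
  proof (intro allI impI)
    fix \<epsilon> :: real assume "\<epsilon> > 0"
    then have "\<epsilon>\<^sup>2 > 0"
      by simp
    with \<open>Cauchy q\<close> obtain M where M: "\<And>m n. m \<ge> M \<Longrightarrow> n > m \<Longrightarrow> dist (q m) (q n) < \<epsilon>\<^sup>2"
      unfolding Cauchy_altdef by blast
    have "dist (s m) (s n) < \<epsilon>" if "m \<ge> M" "n > m" for m n
    proof (rule power_less_imp_less_base)
      have "(dist (s m) (s n))\<^sup>2 \<le> dist (q m) (q n)"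
        using dist_s[of m n] that by (simp add: dist_real_def)
      then show "(dist (s m) (s n))\<^sup>2 < \<epsilon>\<^sup>2"
        using M[OF that] by simp
    qed (use \<open>\<epsilon> > 0\<close> in simp)
    then show "\<exists>M. \<forall>m\<ge>M. \<forall>n>m. dist (s m) (s n) < \<epsilon>"
      by blast
  qed
  then have "convergent s"
    by (rule Cauchy_convergent)
  then show ?thesis
    by (simp add: s_def[abs_def] convergent_LIMSEQ_iff transfer_series_def)
qed

lemma
  assumes e: "orthonormal_on UNIV e" and g: "orthonormal_on UNIV g"
  shows transfer_series_add:
      "transfer_series e g (x + y) = transfer_series e g x + transfer_series e g y"
    and transfer_series_scale: "transfer_series e g (a \<star> x) = a \<star> transfer_series e g x"
    and norm_transfer_series_le: "norm (transfer_series e g x) \<le> norm x"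
    and ip_transfer_series: "ip (transfer_series e g x) (g j) = ip x (e j)"
    and ip_transfer_series_orthogonal: "(\<And>i. ip (g i) y = 0) \<Longrightarrow> ip (transfer_series e g x) y = 0"
proof -
  note lim = transfer_series_LIMSEQ[OF e g]
  show "transfer_series e g (x + y) = transfer_series e g x + transfer_series e g y"
    by (rule LIMSEQ_unique[OF lim])
      (unfold ip_add_left scale_left_distrib sum.distrib, intro tendsto_add lim)
  show "transfer_series e g (a \<star> x) = a \<star> transfer_series e g x"
    by (rule LIMSEQ_unique[OF lim])
      (unfold ip_scale_left scale_scale[symmetric] scale_sum_right[symmetric],
        intro scale.tendsto tendsto_const lim)
  have "norm (\<Sum>i<m. ip x (e i) \<star> g i) \<le> norm x" for m
    using norm_orthonormal_sum[OF orthonormal_on_subset[OF g subset_UNIV], of "{..<m}"]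
      Bessel[OF orthonormal_on_subset[OF e subset_UNIV], of "{..<m}" x]
    by - (rule power2_le_imp_le, simp_all)
  then show "norm (transfer_series e g x) \<le> norm x"
    by (intro LIMSEQ_le_const2[OF tendsto_norm[OF lim]]) auto
  \<comment> \<open>The coefficient at \<open>g j\<close> is constant as soon as
    \<open>m > j\<close>.\<close>
  have "eventually (\<lambda>m. ip (\<Sum>i<m. ip x (e i) \<star> g i) (g j) = ip x (e j)) sequentially"
    using eventually_gt_at_top[of j]
    by eventually_elim (simp add: ip_orthonormal_sum[OF g])
  then show "ip (transfer_series e g x) (g j) = ip x (e j)"
    by (rule LIMSEQ_unique[OF ip.tendsto[OF lim tendsto_const] tendsto_eventually])
  show "ip (transfer_series e g x) y = 0" if "\<And>i. ip (g i) y = 0"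
    using ip.tendsto[OF lim[of x] tendsto_const[of y]]
    by (simp add: ip_sum_left ip_scale_left that LIMSEQ_const_iff)
qed

lemma continuous_transfer_series:
  assumes "orthonormal_on UNIV e" "orthonormal_on UNIV g"
  shows "continuous_on X (transfer_series e g)"
proof -
  have "bounded_linear (transfer_series e g)"
    using transfer_series_scale[OF assms, of "of_real _"]
    by (intro bounded_linear_intro[of _ 1])
      (simp_all add: transfer_series_add[OF assms] norm_transfer_series_le[OF assms] scale_of_real)
  then show ?thesis
    by (rule linear_continuous_on)
qed

text \<open>The shift by \<open>N\<close> on the closed span of \<open>e\<close> plus the identity on its orthogonal complement.\<close>

definition partial_shift :: "(nat \<Rightarrow> 'h) \<Rightarrow> nat \<Rightarrow> 'h \<Rightarrow> 'h" where
  "partial_shift e N x = x - transfer_series e e x + transfer_series e (\<lambda>i. e (i + N)) x"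

context
  fixes e :: "nat \<Rightarrow> 'h" and N :: nat
  assumes e: "orthonormal_on UNIV e"
begin

lemma orthonormal_shift: "orthonormal_on UNIV (\<lambda>i. e (i + N))"
  using e by (simp add: orthonormal_on_def)

lemma partial_shift_add: "partial_shift e N (x + y) = partial_shift e N x + partial_shift e N y"
  by (simp add: partial_shift_def transfer_series_add[OF e] orthonormal_shift e)

lemma partial_shift_scale: "partial_shift e N (a \<star> x) = a \<star> partial_shift e N x"
  by (simp add: partial_shift_def transfer_series_scale[OF e] orthonormal_shift e
      scale_right_distrib scale_right_diff_distrib)

lemma continuous_partial_shift: "continuous_on X (partial_shift e N)"
  unfolding partial_shift_def
  by (intro continuous_intros continuous_transfer_series e orthonormal_shift)

text \<open>The part \<open>x - transfer_series e e x\<close> is orthogonal to every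
  \<open>e i\<close>, so only the shifted series contributes.\<close>

lemma ip_partial_shift: "ip (partial_shift e N x) (e (j + N)) = ip x (e j)"
  using ip_transfer_series[OF e orthonormal_shift, of x j]
  by (simp add: partial_shift_def ip_add_left ip_diff_left ip_transfer_series[OF e e])

lemma ip_partial_shift_zero: "j < N \<Longrightarrow> ip (partial_shift e N x) (e j) = 0"
  using ip_transfer_series_orthogonal[OF e orthonormal_shift, of "e j" x]
  by (simp add: partial_shift_def ip_add_left ip_diff_left ip_transfer_series[OF e e]
      orthonormal_onD[OF e])

text \<open>Comparing coefficients at \<open>e j\<close> gives a recursion with step
  \<open>N\<close>. For \<open>t = 1\<close> it reads off every coefficient of \<open>x\<close> at
  once; otherwise it starts from zeros below \<open>N\<close> and propagates upwards.\<close>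

lemma convex_partial_shift_eq_zero:
  assumes N: "N > 0" and eq: "(1 - t) *\<^sub>R x + t *\<^sub>R partial_shift e N x = 0"
  shows "x = 0"
proof -
  have coeff: "(1 - t) *\<^sub>R ip x (e j) + t *\<^sub>R ip (partial_shift e N x) (e j) = 0" for j
    using arg_cong[OF eq, of "\<lambda>z. ip z (e j)"]
    by (simp add: ip_add_left ip.scaleR_left)
  have zero: "ip x (e j) = 0" for j
  proof (cases "t = 1")
    case True
    then show ?thesis
      using coeff[of "j + N"] by (simp add: ip_partial_shift)
  next
    case False
    show ?thesis
    proof (induction j rule: less_induct)
      case (less j)
      have "ip (partial_shift e N x) (e j) = 0"
      proof (cases "j < N")
        case True
        then show ?thesis
          by (rule ip_partial_shift_zero)
      next
        case False
        then show ?thesis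
          using ip_partial_shift[of x "j - N"] less[of "j - N"] N by simp
      qed
      then show ?case
        using coeff[of j] False by simp
    qed
  qed
  \<comment> \<open>With all coefficients zero, \<open>x\<close> is fixed by the shift, and the
    assumed equation collapses to \<open>x = 0\<close>.\<close>
  have "transfer_series e g x = 0" for g
    by (simp add: transfer_series_def zero)
  then have "partial_shift e N x = x"
    by (simp add: partial_shift_def)
  then show ?thesis
    using eq by (simp add: scaleR_left_diff_distrib)
qed

end

subsection \<open>Gram-Schmidt orthonormalisation\<close>

text \<open>Linear independence of the indexed family rather than of its set of values, so that
  repeated vectors are ruled out.\<close>

definition free_below :: "nat \<Rightarrow> (nat \<Rightarrow> 'h) \<Rightarrow> bool" where
  "free_below N v \<longleftrightarrow> (\<forall>c. (\<Sum>i<N. c i \<star> v i) = 0 \<longrightarrow> (\<forall>i<N. c i = 0))"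

lemma free_belowD: "free_below N v \<Longrightarrow> (\<Sum>i<N. c i \<star> v i) = 0 \<Longrightarrow> i < N \<Longrightarrow> c i = 0"
  unfolding free_below_def by blast

lemma orthonormal_imp_free_below:
  assumes "orthonormal_on {..<N} v"
  shows "free_below N v"
  unfolding free_below_def
proof (intro allI impI)
  fix c i assume "(\<Sum>i<N. c i \<star> v i) = 0" "i < N"
  then show "c i = 0"
    using ip_orthonormal_sum[OF assms finite_lessThan subset_refl, of i c] by simp
qed

text \<open>Meant for the maps \<open>(1 - t) I + t S\<close>, including \<open>S\<close> itself at
  \<open>t = 1\<close>.\<close>

lemma free_below_image:
  assumes v: "free_below N v"
    and add: "\<And>x y. f (x + y) = f x + f y" and scale: "\<And>a x. f (a \<star> x) = a \<star> f x"
    and inj: "\<And>x. f x = 0 \<Longrightarrow> x = 0"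
  shows "free_below N (\<lambda>i. f (v i))"
  unfolding free_below_def
proof (intro allI impI)
  fix c i assume eq: "(\<Sum>i<N. c i \<star> f (v i)) = 0" and "i < N"
  have "f 0 = 0"
    using add[of 0 0] by simp
  then have "f (\<Sum>i\<in>I. c i \<star> v i) = (\<Sum>i\<in>I. c i \<star> f (v i))" for I
    by (induction I rule: infinite_finite_induct) (simp_all add: add scale)
  then show "c i = 0"
    using eq inj v \<open>i < N\<close> by (auto intro: free_belowD)
qed

lemma in_span_lessThanE:
  fixes v :: "nat \<Rightarrow> 'h"
  assumes "x \<in> span (v ` {..<k})"
  obtains c where "x = (\<Sum>i<k. c i \<star> v i)"
proof -
  have "\<exists>c. x = (\<Sum>i<k. c i \<star> v i)"
    using assms
  proof (induction rule: span_induct_alt)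
    case base
    show ?case
      by (intro exI[of _ "\<lambda>_. 0"]) simp
  next
    case (step a y z)
    then obtain j c where j: "j < k" "y = v j" and c: "z = (\<Sum>i<k. c i \<star> v i)"
      by auto
    have "(\<Sum>i<k. (if i = j then a else 0) \<star> v i) = a \<star> v j"
      using j(1) by (simp add: if_distrib[of "\<lambda>a. a \<star> _"] cong: if_cong)
    then have "a \<star> y + z = (\<Sum>i<k. ((if i = j then a else 0) + c i) \<star> v i)"
      by (simp add: j c scale_left_distrib sum.distrib)
    then show ?case
      by (intro exI[of _ "\<lambda>i. (if i = j then a else 0) + c i"])
  qed
  then show ?thesis
    using that by blast
qed

lemma free_below_not_in_span:
  assumes v: "free_below N v" and "k < N"
  shows "v k \<notin> span (v ` {..<k})"
proof
  assume "v k \<in> span (v ` {..<k})"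
  then obtain c where c: "v k = (\<Sum>i<k. c i \<star> v i)"
    by (rule in_span_lessThanE)
  \<comment> \<open>The relation expressing \<open>v k\<close> by its predecessors, padded with
    zeros up to \<open>N\<close>.\<close>
  define d where "d i = (if i < k then c i else if i = k then - 1 else 0)" for i
  have "(\<Sum>i<N. d i \<star> v i) = (\<Sum>i<Suc k. d i \<star> v i)"
    using \<open>k < N\<close> by (intro sum.mono_neutral_right) (auto simp: d_def)
  also have "\<dots> = 0"
    by (simp add: d_def c)
  finally have "d k = 0"
    using free_belowD[OF v _ \<open>k < N\<close>] by blast
  then show False
    by (simp add: d_def)
qed

text \<open>Normalising with \<open>sgn\<close> keeps the process total: a vanishing residual is
  sent to 0.\<close>

function gram_schmidt :: "(nat \<Rightarrow> 'h) \<Rightarrow> nat \<Rightarrow> 'h" where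
  "gram_schmidt v k =
     sgn (v k - (\<Sum>j<k. ip (v k) (gram_schmidt v j) \<star> gram_schmidt v j))"
  by pat_completeness auto
termination
  by (relation "Wellfounded.measure snd") auto

declare gram_schmidt.simps [simp del]

lemma gram_schmidt_in_span: "gram_schmidt v k \<in> span (v ` {..k})"
proof (induction k rule: less_induct)
  case (less k)
  have "gram_schmidt v j \<in> span (v ` {..k})" if "j < k" for j
    using less[OF that] span_mono[of "v ` {..j}" "v ` {..k}"] that by (auto simp: image_mono)
  then have "v k - (\<Sum>j<k. ip (v k) (gram_schmidt v j) \<star> gram_schmidt v j) \<in> span (v ` {..k})"
    by (intro span_diff span_sum span_scale) (auto intro: span_base)
  then show ?case
    by (subst gram_schmidt.simps) (simp add: sgn_div_norm scale_of_real[symmetric] span_scale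
        del: of_real_inverse)
qed

text \<open>The subtracted sum lies in the span of the earlier vectors, so a zero residual would put
  \<open>v k\<close> there too.\<close>

lemma gram_schmidt_residual_nonzero:
  assumes "v k \<notin> span (v ` {..<k})"
  shows "v k - (\<Sum>j<k. ip (v k) (gram_schmidt v j) \<star> gram_schmidt v j) \<noteq> 0"
proof -
  have "gram_schmidt v j \<in> span (v ` {..<k})" if "j < k" for j
  proof -
    have "v ` {..j} \<subseteq> v ` {..<k}"
      using that by (intro image_mono) auto
    then show ?thesis
      using gram_schmidt_in_span span_mono by blast
  qed
  then have "(\<Sum>j<k. ip (v k) (gram_schmidt v j) \<star> gram_schmidt v j) \<in> span (v ` {..<k})"
    by (intro span_sum span_scale) simp
  then show ?thesis
    using assms by auto
qed

lemma gram_schmidt_orthonormal: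
  assumes "\<And>k. k < N \<Longrightarrow> v k \<notin> span (v ` {..<k})"
  shows "orthonormal_on {..<N} (gram_schmidt v)"
  using assms
proof (induction N)
  case 0
  then show ?case
    by (simp add: orthonormal_on_def)
next
  case (Suc k)
  define r where "r = v k - (\<Sum>j<k. ip (v k) (gram_schmidt v j) \<star> gram_schmidt v j)"
  have gs: "gram_schmidt v k = of_real (inverse (norm r)) \<star> r"
    by (subst gram_schmidt.simps) (simp add: r_def sgn_div_norm scale_of_real del: of_real_inverse)
  have "r \<noteq> 0"
    unfolding r_def by (rule gram_schmidt_residual_nonzero) (simp add: Suc.prems)
  then have unit: "ip (gram_schmidt v k) (gram_schmidt v k) = 1"
    unfolding ip_self gs norm_scale by (simp add: norm_inverse)
  have on: "orthonormal_on {..<k} (gram_schmidt v)"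
    using Suc by simp
  have orth: "ip (gram_schmidt v k) (gram_schmidt v j) = 0" if "j < k" for j
    unfolding gs ip_scale_left r_def ip_diff_left
    using ip_orthonormal_sum[OF on finite_lessThan subset_refl, of j] that by simp
  with unit on show ?case
    unfolding orthonormal_on_def lessThan_Suc
    using ip_eq_zero_commute by auto
qed

text \<open>Inductively the earlier outputs equal the inputs, so nothing is subtracted and the norm
  is already 1. This identifies the ends of the homotopies.\<close>

lemma gram_schmidt_id:
  assumes "orthonormal_on {..<N} v" "k < N"
  shows "gram_schmidt v k = v k"
  using assms(2)
proof (induction k rule: less_induct)
  case (less k)
  have "(\<Sum>j<k. ip (v k) (gram_schmidt v j) \<star> gram_schmidt v j) = 0"
    using less assms(1) by (intro sum.neutral) (auto simp: orthonormal_onD)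
  then show ?case
    using norm_orthonormal[OF assms(1), of k] less.prems
    by (subst gram_schmidt.simps) (simp add: sgn_div_norm)
qed

text \<open>The only discontinuity of \<open>sgn\<close> is at 0, and freeness keeps the residuals
  away from it.\<close>

lemma continuous_on_gram_schmidt:
  assumes cont: "\<And>k. k < N \<Longrightarrow> continuous_on X (\<lambda>x. F x k)"
    and free: "\<And>x. x \<in> X \<Longrightarrow> free_below N (F x)" and "k < N"
  shows "continuous_on X (\<lambda>x. gram_schmidt (F x) k)"
  using \<open>k < N\<close>
proof (induction k rule: less_induct)
  case (less k)
  have "continuous_on X (\<lambda>x. F x k -
      (\<Sum>j<k. ip (F x k) (gram_schmidt (F x) j) \<star> gram_schmidt (F x) j))"
    using less by (intro continuous_intros scale.continuous_on ip.continuous_on cont) auto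
  moreover have "F x k - (\<Sum>j<k. ip (F x k) (gram_schmidt (F x) j) \<star> gram_schmidt (F x) j) \<noteq> 0"
    if "x \<in> X" for x
    using gram_schmidt_residual_nonzero free_below_not_in_span[OF free[OF that] less.prems] by blast
  ultimately show ?case
    unfolding gram_schmidt.simps[of _ k] by (intro continuous_on_sgn) auto
qed

text \<open>A Hamel basis is infinite, hence contains an independent sequence, which Gram-Schmidt
  orthonormalises.\<close>

lemma infinite_dim_orthonormal_sequence:
  assumes "\<And>B. finite B \<Longrightarrow> span B \<noteq> UNIV"
  obtains e :: "nat \<Rightarrow> 'h" where "orthonormal_on UNIV e"
proof -
  obtain B where B: "independent B" and "UNIV \<subseteq> span B"
    by (rule maximal_independent_subset)
  then have "infinite B"
    using assms[of B] by (auto simp: top_unique)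
  then obtain v :: "nat \<Rightarrow> 'h" where v: "inj v" "range v \<subseteq> B"
    using infinite_countable_subset by blast
  have "v k \<notin> span (v ` {..<k})" for k
  proof -
    have "v ` {..<k} \<subseteq> B - {v k}"
      using v by (auto dest: injD)
    then have "span (v ` {..<k}) \<subseteq> span (B - {v k})"
      by (rule span_mono)
    moreover have "v k \<notin> span (B - {v k})"
      using B(1) v(2) unfolding dependent_def by (auto simp: subset_iff)
    ultimately show ?thesis
      by (rule contra_subsetD)
  qed
  then have "orthonormal_on {..<N} (gram_schmidt v)" for N
    by (intro gram_schmidt_orthonormal)
  then have "ip (gram_schmidt v i) (gram_schmidt v j) = (if i = j then 1 else 0)" for i j
    \<comment> \<open>Each pair of indices already lies in a finite initial segment.\<close>
    by (rule orthonormal_onD[of "{..<Suc (max i j)}"]) (simp_all add: less_Suc_eq_le)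
  then have "orthonormal_on UNIV (gram_schmidt v)"
    by (simp add: orthonormal_on_def)
  then show ?thesis
    using that by blast
qed

subsection \<open>Contractibility\<close>

text \<open>Gram-Schmidt needs an ordered index set, whereas \<open>'n\<close> is merely finite;
  \<open>idx\<close> supplies an enumeration.\<close>

context
  fixes idx :: "'n::finite \<Rightarrow> nat"
  assumes idx: "bij_betw idx UNIV {..<CARD('n)}"
begin

definition to_seq :: "'h ^ 'n \<Rightarrow> nat \<Rightarrow> 'h" where
  "to_seq v k = v $ inv idx k"

lemma inv_idx [simp]: "inv idx (idx i) = i"
  using idx by (simp add: bij_betw_def)

lemma idx_less [simp]: "idx i < CARD('n)"
  using idx bij_betwE by fastforce

lemma idx_inv [simp]: "k < CARD('n) \<Longrightarrow> idx (inv idx k) = k"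
  using idx by (simp add: bij_betw_def f_inv_into_f)

lemma vec_in_St_orth:
  assumes "orthonormal_on {..<CARD('n)} s"
  shows "(\<chi> i. s (idx i)) \<in> (St_orth ip :: ('h ^ 'n) set)"
  using assms by (auto simp: St_orth_def orthonormal_on_def) (metis inv_idx)

lemma orthonormal_to_seq:
  assumes "v \<in> St_orth ip"
  shows "orthonormal_on {..<CARD('n)} (to_seq v)"
  using assms by (auto simp: St_orth_def orthonormal_on_def to_seq_def) (metis idx_inv)

text \<open>Orthonormalising pointwise pushes a homotopy through free families into the Stiefel
  set.\<close>

lemma gram_schmidt_homotopic:
  fixes F :: "real \<Rightarrow> 'h ^ 'n \<Rightarrow> nat \<Rightarrow> 'h"
  assumes cont: "\<And>k. k < CARD('n) \<Longrightarrow>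
      continuous_on ({0..1} \<times> St_orth ip) (\<lambda>x. F (fst x) (snd x) k)"
    and free: "\<And>t v. t \<in> {0..1} \<Longrightarrow> v \<in> St_orth ip \<Longrightarrow> free_below CARD('n) (F t v)"
  shows "homotopic_with_canon (\<lambda>_. True) (St_orth ip) (St_orth ip)
      (\<lambda>v. \<chi> i. gram_schmidt (F 0 v) (idx i)) (\<lambda>v. \<chi> i. gram_schmidt (F 1 v) (idx i))"
proof -
  define h where "h x = (\<chi> i. gram_schmidt (F (fst x) (snd x)) (idx i))" for x
  have "continuous_on ({0..1} \<times> St_orth ip) h"
    unfolding h_def
    by (intro continuous_on_vec_lambda continuous_on_gram_schmidt[where N = "CARD('n)"])
      (auto intro: cont free)
  moreover have "h x \<in> St_orth ip" if "x \<in> {0..1} \<times> St_orth ip" for x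
    unfolding h_def
    using that free by (intro vec_in_St_orth gram_schmidt_orthonormal free_below_not_in_span) auto
  ultimately show ?thesis
    unfolding homotopic_with_def
    by (intro exI[of _ h]) (auto simp: h_def)
qed

end

text \<open>Nonemptiness is stated separately because \<open>contractible\<close> also holds for the
  empty set.\<close>

lemma St_orth_contractible:
  assumes inf: "\<And>B. finite B \<Longrightarrow> span B \<noteq> UNIV"
  shows "St_orth ip \<noteq> ({} :: ('h ^ 'n::finite) set) \<and> contractible (St_orth ip :: ('h ^ 'n) set)"
proof -
  let ?N = "CARD('n)" and ?St = "St_orth ip :: ('h ^ 'n) set"
  obtain idx :: "'n \<Rightarrow> nat" where idx: "bij_betw idx UNIV {..<?N}"
    using ex_bij_betw_finite_nat[of "UNIV :: 'n set"] by (auto simp: atLeast0LessThan)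
  obtain e :: "nat \<Rightarrow> 'h" where e: "orthonormal_on UNIV e"
    using inf infinite_dim_orthonormal_sequence by blast
  define w :: "'h ^ 'n" where "w = (\<chi> i. e (idx i))"
  \<comment> \<open>Shifting by exactly \<open>?N\<close> makes the range of \<open>S\<close>
    orthogonal to all entries of \<open>w\<close>.\<close>
  define S where "S = partial_shift e ?N"
  define sq where "sq = to_seq idx"
  have e_N: "orthonormal_on {..<?N} e"
    using e by (rule orthonormal_on_subset) simp
  have w: "w \<in> ?St"
    unfolding w_def by (rule vec_in_St_orth[OF idx e_N])
  note S_linear = partial_shift_add[OF e, of ?N, folded S_def]
    partial_shift_scale[OF e, of ?N, folded S_def]
  have S_inj: "x = 0" if "(1 - t) *\<^sub>R x + t *\<^sub>R S x = 0" for t x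
    using convex_partial_shift_eq_zero[OF e zero_less_card_finite] that unfolding S_def by blast
  have S_cont: "continuous_on X S" for X
    unfolding S_def by (rule continuous_partial_shift[OF e])
  have sq_on: "orthonormal_on {..<?N} (sq v)" if "v \<in> ?St" for v
    unfolding sq_def by (rule orthonormal_to_seq[OF idx that])
  have sq_free: "free_below ?N (sq v)" if "v \<in> ?St" for v
    using sq_on[OF that] by (rule orthonormal_imp_free_below)
  have sq_cont: "continuous_on X (\<lambda>x. sq (f x) k)" if "continuous_on X f" for X f k
    unfolding sq_def to_seq_def[OF idx] by (intro continuous_intros that)

  \<comment> \<open>First segment, from \<open>v\<close> to \<open>S v\<close>.\<close>
  define F where "F t v k = (1 - t) *\<^sub>R sq v k + t *\<^sub>R S (sq v k)" for t v k
  have 1: "homotopic_with_canon (\<lambda>_. True) ?St ?St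
      (\<lambda>v. \<chi> i. gram_schmidt (F 0 v) (idx i)) (\<lambda>v. \<chi> i. gram_schmidt (F 1 v) (idx i))"
  proof (rule gram_schmidt_homotopic[OF idx])
    show "continuous_on ({0..1} \<times> ?St) (\<lambda>x. F (fst x) (snd x) k)" for k
      unfolding F_def
      by (intro continuous_intros sq_cont continuous_on_compose2[OF S_cont[of UNIV]]) auto
    fix t :: real and v assume "v \<in> ?St"
    show "free_below ?N (F t v)"
      unfolding F_def
      by (rule free_below_image[OF sq_free[OF \<open>v \<in> ?St\<close>], of "\<lambda>x. (1 - t) *\<^sub>R x + t *\<^sub>R S x"])
        (simp_all add: S_linear scaleR_right_distrib scaleR_scale scale_right_distrib, rule S_inj)
  qed

  \<comment> \<open>Second segment, from \<open>S v\<close> to the fixed frame.\<close>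
  define G where "G t v k = (1 - t) *\<^sub>R S (sq v k) + t *\<^sub>R e k" for t v k
  have 2: "homotopic_with_canon (\<lambda>_. True) ?St ?St
      (\<lambda>v. \<chi> i. gram_schmidt (G 0 v) (idx i)) (\<lambda>v. \<chi> i. gram_schmidt (G 1 v) (idx i))"
  proof (rule gram_schmidt_homotopic[OF idx])
    show "continuous_on ({0..1} \<times> ?St) (\<lambda>x. G (fst x) (snd x) k)" for k
      unfolding G_def
      by (intro continuous_intros sq_cont continuous_on_compose2[OF S_cont[of UNIV]]) auto
    fix t :: real and v assume v: "v \<in> ?St"
    have Sv_free: "free_below ?N (\<lambda>k. S (sq v k))"
      by (rule free_below_image[OF sq_free[OF v] S_linear], rule S_inj[of 1]) simp
    show "free_below ?N (G t v)"
      unfolding free_below_def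
    proof (intro allI impI)
      fix c i assume eq: "(\<Sum>k<?N. c k \<star> G t v k) = 0" and i: "i < ?N"
      have G_eq: "(1 - t) *\<^sub>R (\<Sum>k<?N. c k \<star> S (sq v k)) + t *\<^sub>R (\<Sum>k<?N. c k \<star> e k) = 0"
        using eq by (simp add: G_def scaleR_sum_right scaleR_scale scale_right_distrib sum.distrib)
      \<comment> \<open>Pairing the relation with \<open>e j\<close> kills the \<open>S\<close> part
        and isolates \<open>c j\<close>. This settles \<open>t \<noteq> 0\<close>; for
        \<open>t = 0\<close> the relation is one among the vectors
        \<open>S (sq v k)\<close>.\<close>
      have "t *\<^sub>R c j = 0" if "j < ?N" for j
      proof -
        have "ip (\<Sum>k<?N. c k \<star> S (sq v k)) (e j) = 0"
          by (simp add: ip_sum_left ip_scale_left S_def ip_partial_shift_zero[OF e that])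
        moreover have "ip (\<Sum>k<?N. c k \<star> e k) (e j) = c j"
          using ip_orthonormal_sum[OF e_N finite_lessThan subset_refl, of j c] that by simp
        ultimately show ?thesis
          using arg_cong[OF G_eq, of "\<lambda>z. ip z (e j)"]
          by (simp add: ip_add_left ip.scaleR_left)
      qed
      then show "c i = 0"
        using G_eq free_belowD[OF Sv_free _ i] i by (cases "t = 0") auto
    qed
  qed

  have "homotopic_with_canon (\<lambda>_. True) ?St ?St id (\<lambda>v. \<chi> i. gram_schmidt (F 1 v) (idx i))"
  proof (rule homotopic_with_eq[OF 1])
    fix v assume "v \<in> topspace (top_of_set ?St)"
    then show "id v = (\<chi> i. gram_schmidt (F 0 v) (idx i))"
      using gram_schmidt_id[OF sq_on idx_less[OF idx]]
      by (simp add: F_def[abs_def] vec_eq_iff) (simp add: sq_def to_seq_def[OF idx] inv_idx[OF idx])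
  qed auto
  moreover have "homotopic_with_canon (\<lambda>_. True) ?St ?St
      (\<lambda>v. \<chi> i. gram_schmidt (F 1 v) (idx i)) (\<lambda>v. w)"
    \<comment> \<open>The homotopies fit together because \<open>F 1 v\<close> and
      \<open>G 0 v\<close> are both \<open>S\<close> applied to \<open>sq v\<close>;
      \<open>G 1 v\<close> is \<open>e\<close>, which Gram-Schmidt fixes below
      \<open>?N\<close>.\<close>
    by (rule homotopic_with_eq[OF 2])
      (auto simp: F_def[abs_def] G_def[abs_def] w_def gram_schmidt_id[OF e_N] idx_less[OF idx])
  ultimately have "homotopic_with_canon (\<lambda>_. True) ?St ?St id (\<lambda>v. w)"
    by (rule homotopic_with_trans)
  then show ?thesis
    using w unfolding contractible_def by blast
qed

end

theorem theorem4p4: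
  shows
    "(separable_space (euclidean :: 'r::{real_inner, complete_space} topology) \<and>
      (\<forall>B :: 'r set. finite B \<longrightarrow> span B \<noteq> UNIV)
      \<longrightarrow>
      St_orth inner \<noteq> ({} :: ('r ^ 'n::finite) set) \<and>
      contractible (St_orth inner :: ('r ^ 'n) set) \<and>
      connected (St_orth inner :: ('r ^ 'n) set))
     \<and>
     (separable_space (euclidean :: 'c::{complex_inner, complete_space} topology) \<and>
      (\<forall>B :: 'c set. finite B \<longrightarrow> complex_vector.span B \<noteq> UNIV)
      \<longrightarrow>
      St_orth cinner \<noteq> ({} :: ('c ^ 'n) set) \<and>
      contractible (St_orth cinner :: ('c ^ 'n) set) \<and>
      connected (St_orth cinner :: ('c ^ 'n) set))"
proof -
  interpret R: complete_inner_space "scaleR :: real \<Rightarrow> 'r \<Rightarrow> 'r" inner "\<lambda>x. x"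
    by unfold_locales
      (rule inner_commute | simp add: inner_add_left dot_square_norm power2_eq_square)+
  \<comment> \<open>The class axioms tie the norm to the real part only; conjugate symmetry makes
    the imaginary part vanish.\<close>
  have cinner_self: "cinner x x = of_real ((norm x)\<^sup>2)" for x :: 'c
  proof (rule complex_eqI)
    have "(norm x)\<^sup>2 = Re (cinner x x)"
      unfolding norm_eq_sqrt_cinner by (rule real_sqrt_pow2[OF cinner_ge_zero])
    then show "Re (cinner x x) = Re (of_real ((norm x)\<^sup>2))"
      by (simp only: Re_complex_of_real)
    show "Im (cinner x x) = Im (of_real ((norm x)\<^sup>2))"
    proof -
      have "cinner x x \<in> \<real>"
        unfolding Reals_cnj_iff by (rule cinner_commute[symmetric])
      then show ?thesis
        by (simp only: complex_is_Real_iff Im_complex_of_real)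
    qed
  qed
  interpret C: complete_inner_space "scaleC :: complex \<Rightarrow> 'c \<Rightarrow> 'c" cinner cnj
    by unfold_locales
      (rule scaleC_of_real cinner_commute cinner_add_left cinner_scaleC_left cinner_self
        complex_cnj_add complex_cnj_mult complex_norm_square[symmetric])+
  have "St_orth inner \<noteq> ({} :: ('r ^ 'n) set) \<and> contractible (St_orth inner :: ('r ^ 'n) set)"
    if "\<forall>B :: 'r set. finite B \<longrightarrow> span B \<noteq> UNIV"
    by (rule R.St_orth_contractible) (use that in \<open>simp add: span_raw_def\<close>)
  moreover have "St_orth cinner \<noteq> ({} :: ('c ^ 'n) set) \<and> contractible (St_orth cinner :: ('c ^ 'n) set)"
    if "\<forall>B :: 'c set. finite B \<longrightarrow> complex_vector.span B \<noteq> UNIV"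
    by (rule C.St_orth_contractible) (use that in simp)
  ultimately show ?thesis
    by (simp add: contractible_imp_connected)
qed

end
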